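(* Let $n\ge1$, $p_1,\dots,p_n\in(0,1)$, $q_i=1-p_i$, let $m_1,\dots,m_n$ be positive integers, and put $w_i=\log(p_i/q_i)$ and $\Phi=\sum_{i=1}^n(p_i-\frac12)w_i$. Consider the committee of $n$ experts with random votes $\mathbf{X}$, truth $Y$ and committee profile $\mathbf{K}$ described in the context, and let $\hat f^{\mathrm{HC}}$ be the plug-in rule $$\hat f^{\mathrm{HC}}(\mathbf{x},\mathbf{k})=\operatorname{sign}\left(\sum_{i=1}^n\hat w_i^{\mathrm{HC}}x_i\right),\qquad \hat w_i^{\mathrm{HC}}=\log\frac{\hat p_i}{1-\hat p_i},\quad \hat p_i=\frac{k_i}{m_i}.$$ Let $0<\delta<1$ and $0<\varepsilon<\min\{5,2\Phi/n\}$. If $$m_i\min\{p_i,q_i\}\ge 3\left(\frac{\sqrt{4\varepsilon+1}-1}{4}\right)^{-2}\log\frac{4n}{\delta},\qquad i=1,\dots,n,$$ then $$\mathbb{P}\left(\hat f^{\mathrm{HC}}(\mathbf{X},\mathbf{K})\neq Y\right)\le\delta+\exp\left[-\frac{(2\Phi-\varepsilon n)^2}{8\Phi}\right].$$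
   Context: Setting: $Y\in\{\pm1\}$ is uniform; $\mathbf{X}=(X_1,\dots,X_n)\in\{\pm1\}^n$ are the expert votes; the correctness indicators $\xi_i=\mathbf{1}\{X_i=Y\}$ are mutually independent and jointly independent of $Y$, with $\mathbb{P}(X_i=Y)=p_i$. In addition, expert $i$ has previously been queried independently $m_i$ times ($m_i$ fixed) and was correct $k_i$ times; thus the committee profile $\mathbf{K}=(k_1,\dots,k_n)$ has independent components $k_i\sim\mathrm{Binomial}(m_i,p_i)$ and is independent of $(\mathbf{X},Y)$. Weights may be infinite: $\hat w_i^{\mathrm{HC}}=+\infty$ if $\hat p_i=1$ and $-\infty$ if $\hat p_i=0$. With $\eta_i=2\xi_i-1$, the error event $\{\hat f^{\mathrm{HC}}(\mathbf{X},\mathbf{K})\ne Y\}$ is the event that $\sum_{i=1}^n\hat w_i^{\mathrm{HC}}\eta_i\le0$ (ties count as errors) or that this sum involves $\infty-\infty$ (also counted as an error). *)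

theory Defs
  imports "HOL-Probability.Probability"
begin

definition log_odds :: "real \<Rightarrow> real" where
  "log_odds p = ln (p / (1 - p))"

definition committee_potential :: "nat \<Rightarrow> (nat \<Rightarrow> real) \<Rightarrow> real" where
  "committee_potential n p = (\<Sum>i=1..n. (p i - 1/2) * log_odds (p i))"

(* The two extreme cases are needed because ln 0 = 0 and x / 0 = 0 in HOL. *)
definition hc_weight :: "nat \<Rightarrow> nat \<Rightarrow> ereal" where
  "hc_weight m k =
     (let p_hat = real k / real m in
      if p_hat = 1 then \<infinity> else if p_hat = 0 then -\<infinity> else ereal (log_odds p_hat))"

(* ereal arithmetic has \<infinity> + (-\<infinity>) = \<infinity>, so sums of this form have to be
   recognised separately. *)
definition indeterminate_sum :: "nat \<Rightarrow> (nat \<Rightarrow> ereal) \<Rightarrow> bool" where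
  "indeterminate_sum n t \<longleftrightarrow> (\<exists>i\<in>{1..n}. t i = \<infinity>) \<and> (\<exists>j\<in>{1..n}. t j = -\<infinity>)"

(* The value 0, taken on ties and on indeterminate sums, differs from both labels 1 and -1;
   these outcomes therefore always count as errors (see hc_error_iff below). *)
definition hc_rule :: "nat \<Rightarrow> (nat \<Rightarrow> nat) \<Rightarrow> (nat \<Rightarrow> real) \<Rightarrow> (nat \<Rightarrow> nat) \<Rightarrow> ereal" where
  "hc_rule n m x k =
     (let t = (\<lambda>i. hc_weight (m i) (k i) * ereal (x i)) in
      if indeterminate_sum n t then 0 else sgn (\<Sum>i=1..n. t i))"

(* Independence of two random variables. The library's indep_var requires both variables
   to take values in the same type. *)
definition (in prob_space) indep_rv ::
    "'b measure \<Rightarrow> ('a \<Rightarrow> 'b) \<Rightarrow> 'c measure \<Rightarrow> ('a \<Rightarrow> 'c) \<Rightarrow> bool" where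
  "indep_rv S A T B \<longleftrightarrow>
     random_variable S A \<and> random_variable T B \<and>
     indep_set {A -` U \<inter> space M | U. U \<in> sets S} {B -` V \<inter> space M | V. V \<in> sets T}"

locale expert_committee = prob_space M for M :: "'a measure" +
  fixes n :: nat
    and p :: "nat \<Rightarrow> real"
    and m :: "nat \<Rightarrow> nat"
    and X :: "nat \<Rightarrow> 'a \<Rightarrow> real"
    and Y :: "'a \<Rightarrow> real"
    and K :: "nat \<Rightarrow> 'a \<Rightarrow> nat"
  assumes Y_measurable: "random_variable borel Y"
    and Y_values: "\<And>\<omega>. \<omega> \<in> space M \<Longrightarrow> Y \<omega> \<in> {-1, 1}"
    and Y_uniform: "prob {\<omega> \<in> space M. Y \<omega> = 1} = 1/2"
    and X_measurable: "\<And>i. i \<in> {1..n} \<Longrightarrow> random_variable borel (X i)"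
    and X_values: "\<And>i \<omega>. i \<in> {1..n} \<Longrightarrow> \<omega> \<in> space M \<Longrightarrow> X i \<omega> \<in> {-1, 1}"
    and competence: "\<And>i. i \<in> {1..n} \<Longrightarrow> prob {\<omega> \<in> space M. X i \<omega> = Y \<omega>} = p i"
    and correct_indep:
      "indep_vars (\<lambda>_. count_space UNIV) (\<lambda>i \<omega>. of_bool (X i \<omega> = Y \<omega>) :: nat) {1..n}"
    and correct_indep_truth:
      "indep_rv (PiM {1..n} (\<lambda>_. count_space UNIV))
                (\<lambda>\<omega>. \<lambda>i\<in>{1..n}. of_bool (X i \<omega> = Y \<omega>) :: nat)
                borel Y"
    and K_binomial:
      "\<And>i. i \<in> {1..n} \<Longrightarrow>
         distr M (count_space UNIV) (K i) = measure_pmf (binomial_pmf (m i) (p i))"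
    and K_indep: "indep_vars (\<lambda>_. count_space UNIV) K {1..n}"
    and K_indep_votes_truth:
      "indep_rv (PiM {1..n} (\<lambda>_. count_space UNIV)) (\<lambda>\<omega>. \<lambda>i\<in>{1..n}. K i \<omega>)
                (PiM {1..n} (\<lambda>_. borel) \<Otimes>\<^sub>M borel) (\<lambda>\<omega>. (\<lambda>i\<in>{1..n}. X i \<omega>, Y \<omega>))"

lemma sum_uminus_ereal:
  fixes t :: "'i \<Rightarrow> ereal"
  assumes "finite I" "\<not> ((\<exists>i\<in>I. t i = \<infinity>) \<and> (\<exists>j\<in>I. t j = -\<infinity>))"
  shows "(\<Sum>i\<in>I. - t i) = - (\<Sum>i\<in>I. t i)"
proof (cases "\<exists>i\<in>I. t i = \<infinity>")
  case True
  then have "\<forall>j\<in>I. t j \<noteq> -\<infinity>" using assms by auto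
  with assms(1) have "(\<Sum>i\<in>I. - t i) = - (\<Sum>i\<in>I. t i) \<and> (\<Sum>i\<in>I. t i) \<noteq> -\<infinity>"
  proof (induction I rule: finite_induct)
    case (insert i I)
    then show ?case by (cases "t i"; cases "\<Sum>i\<in>I. t i") auto
  qed simp
  then show ?thesis ..
next
  case False
  with assms(1) have "(\<Sum>i\<in>I. - t i) = - (\<Sum>i\<in>I. t i) \<and> (\<Sum>i\<in>I. t i) \<noteq> \<infinity>"
  proof (induction I rule: finite_induct)
    case (insert i I)
    then show ?case by (cases "t i"; cases "\<Sum>i\<in>I. t i") auto
  qed simp
  then show ?thesis ..
qed

lemma sgn_ereal_eq_1_iff: "sgn (s::ereal) = 1 \<longleftrightarrow> s > 0"
  by (cases s) (auto simp: sgn_if one_ereal_def)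

lemma sgn_ereal_eq_m1_iff: "sgn (s::ereal) = -1 \<longleftrightarrow> s < 0"
  by (cases s) (auto simp: sgn_if one_ereal_def)

lemma (in expert_committee) hc_error_iff:
  assumes "\<omega> \<in> space M"
  defines "t \<equiv> (\<lambda>i. hc_weight (m i) (K i \<omega>) * ereal (2 * of_bool (X i \<omega> = Y \<omega>) - 1))"
  shows "hc_rule n m (\<lambda>i. X i \<omega>) (\<lambda>i. K i \<omega>) \<noteq> ereal (Y \<omega>) \<longleftrightarrow>
           indeterminate_sum n t \<or> (\<Sum>i=1..n. t i) \<le> 0"
proof -
  define s where "s = (\<lambda>i. hc_weight (m i) (K i \<omega>) * ereal (X i \<omega>))"
  have rule: "hc_rule n m (\<lambda>i. X i \<omega>) (\<lambda>i. K i \<omega>) =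
      (if indeterminate_sum n s then 0 else sgn (\<Sum>i=1..n. s i))"
    by (simp add: hc_rule_def s_def Let_def)
  have X: "X i \<omega> = -1 \<or> X i \<omega> = 1" if "i \<in> {1..n}" for i
    using X_values[OF that assms(1)] by auto
  show ?thesis
  proof (cases "Y \<omega> = 1")
    case True
    have eq: "t i = s i" if "i \<in> {1..n}" for i
      using X[OF that] True by (auto simp: t_def s_def)
    then have "indeterminate_sum n t = indeterminate_sum n s"
      by (auto simp: indeterminate_sum_def)
    moreover have "(\<Sum>i=1..n. t i) = (\<Sum>i=1..n. s i)"
      using eq by (intro sum.cong) auto
    ultimately show ?thesis
      using True sgn_ereal_eq_1_iff[of "\<Sum>i=1..n. s i"]
      by (auto simp: rule simp flip: one_ereal_def)
  next
    case False
    then have Y: "Y \<omega> = -1" using Y_values[OF assms(1)] by auto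
    have eq: "t i = - s i" if "i \<in> {1..n}" for i
      using X[OF that] Y by (auto simp: t_def s_def simp flip: uminus_ereal.simps(1))
    then have ind: "indeterminate_sum n t = indeterminate_sum n s"
      by (auto simp: indeterminate_sum_def ereal_uminus_eq_reorder)
    have "(\<Sum>i=1..n. t i) = - (\<Sum>i=1..n. s i)" if "\<not> indeterminate_sum n s"
    proof -
      have "(\<Sum>i=1..n. t i) = (\<Sum>i=1..n. - s i)"
        using eq by (intro sum.cong) auto
      also have "\<dots> = - (\<Sum>i=1..n. s i)"
        using that by (intro sum_uminus_ereal) (auto simp: indeterminate_sum_def)
      finally show ?thesis .
    qed
    moreover have "ereal (Y \<omega>) = -1" by (simp add: Y one_ereal_def)
    ultimately show ?thesis
      using ind sgn_ereal_eq_m1_iff[of "\<Sum>i=1..n. s i"]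
      by (cases "indeterminate_sum n s") (auto simp: rule not_less)
  qed
qed

end

theory Submission
  imports Defs
begin

(* Off an event of probability at most \<delta>, every frequency k_i/m_i is within relative error r of p_i
   and its complement within r of q_i, where 2r + 4r^2 = \<epsilon>; this puts each plug-in weight within \<epsilon>
   of the true one, so an error forces \<Sum> w_i \<eta>_i \<le> n \<epsilon>. Exponential moments control
   both events: a quadratic bound on exp for the frequencies, and the Kearns-Saul inequality for
   the weighted vote, which amounts to concavity of y \<mapsto> ln (cosh (sqrt y)). *)

section \<open>Hyperbolic inequalities and the Kearns-Saul bound\<close>

text \<open>The derivative of ln (cosh (sqrt y)) at y = x^2 is tanh x / (2 x), so this is the
  concavity on which the Kearns-Saul bound rests.\<close>

lemma tanh_over_antimono:
  fixes u v :: real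
  assumes "0 < u" "u \<le> v"
  shows "tanh v / v \<le> tanh u / u"
proof (rule DERIV_nonpos_imp_nonincreasing[OF assms(2)])
  fix x :: real assume x: "u \<le> x" "x \<le> v"
  have x0: "x > 0" using x assms by simp
  \<comment> \<open>The numerator of the derivative of tanh x / x is x / (cosh x)^2 - tanh x;
    multiplied by (cosh x)^2 it becomes x - sinh x cosh x.\<close>
  have "x \<le> sinh x * cosh x"
  proof -
    have "x \<le> sinh x"
    proof -
      have "sinh 0 - 0 \<le> sinh x - x"
        by (rule DERIV_nonneg_imp_nondecreasing[of 0 x "\<lambda>x. sinh x - x"])
          (use x0 in \<open>auto intro!: exI derivative_eq_intros simp: cosh_real_ge_1\<close>)
      then show ?thesis by simp
    qed
    also have "\<dots> \<le> sinh x * cosh x"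
      using x0 cosh_real_ge_1[of x] by (simp add: mult_le_cancel_left1)
    finally show ?thesis .
  qed
  then have "1 / (cosh x)\<^sup>2 * x \<le> tanh x"
    using cosh_real_pos[of x] by (simp add: tanh_def field_simps power2_eq_square)
  moreover have "(1 - (tanh x)\<^sup>2) = 1 / (cosh x)\<^sup>2"
    using cosh_square_eq[of x] add_pos_nonneg[of 1 "(sinh x)\<^sup>2"]
    by (simp add: tanh_def power_divide divide_eq_eq eq_divide_eq left_diff_distrib)
  ultimately have le: "(1 - (tanh x)\<^sup>2) * x \<le> tanh x" by simp
  have "((\<lambda>x. tanh x / x) has_real_derivative ((1 - (tanh x)\<^sup>2) * x - tanh x) / (x * x)) (at x)"
    using x0 by (auto intro!: derivative_eq_intros)
  moreover have "((1 - (tanh x)\<^sup>2) * x - tanh x) / (x * x) \<le> 0"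
    using le x0 by (auto simp: divide_le_0_iff)
  ultimately show "\<exists>y. ((\<lambda>x. tanh x / x) has_real_derivative y) (at x) \<and> y \<le> 0"
    by blast
qed

text \<open>A concave function lies below its tangent: for y \<mapsto> ln (cosh (sqrt y)) the
  tangent at v^2 has slope tanh v / (2 v), here called \<open>c\<close>. Equivalently, cosh x exp (-
  c x^2) does not decrease up to v, because 2 c = tanh v / v is at most tanh x / x there.\<close>

lemma cosh_ratio_bound:
  fixes u v :: real
  assumes "0 \<le> u" "u \<le> v" "0 < v"
  shows "cosh u / cosh v \<le> exp ((u\<^sup>2 - v\<^sup>2) * (tanh v / (2 * v)))"
proof -
  define c where "c = tanh v / (2 * v)"
  have "cosh u * exp (- (u\<^sup>2 * c)) \<le> cosh v * exp (- (v\<^sup>2 * c))"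
  proof (rule DERIV_nonneg_imp_nondecreasing[OF assms(2)])
    fix x :: real assume x: "u \<le> x" "x \<le> v"
    have "2 * x * c * cosh x \<le> sinh x"
    proof (cases "x = 0")
      case False
      then have x0: "x > 0" using x assms by simp
      have "2 * c \<le> tanh x / x"
        using tanh_over_antimono[OF x0 x(2)] by (simp add: c_def)
      then have "2 * c * x \<le> tanh x" using x0 by (simp add: field_simps)
      then show ?thesis
        using cosh_real_pos[of x] by (simp add: tanh_def field_simps)
    qed simp
    then have "0 \<le> exp (- (x\<^sup>2 * c)) * (sinh x - 2 * x * c * cosh x)" by simp
    moreover have "((\<lambda>x. cosh x * exp (- (x\<^sup>2 * c))) has_real_derivative
        exp (- (x\<^sup>2 * c)) * (sinh x - 2 * x * c * cosh x)) (at x)"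
      by (auto intro!: derivative_eq_intros simp: algebra_simps)
    ultimately show "\<exists>y. ((\<lambda>x. cosh x * exp (- (x\<^sup>2 * c))) has_real_derivative y) (at x) \<and> 0 \<le> y"
      by blast
  qed
  then have "cosh u / cosh v \<le> exp (u\<^sup>2 * c) * exp (- (v\<^sup>2 * c))"
    using cosh_real_pos[of v] by (simp add: field_simps exp_minus)
  also have "\<dots> = exp ((u\<^sup>2 - v\<^sup>2) * c)" by (simp add: exp_add[symmetric] algebra_simps)
  finally show ?thesis by (simp add: c_def)
qed

text \<open>The Kearns--Saul inequality at the multiples of the log-odds that Chernoff's method needs.
  Writing \<open>v\<close> for half of the log-odds, the left side is the ratio of the hyperbolic cosines
  of \<open>v (1 - 2 s)\<close> and \<open>v\<close>.\<close>
lemma kearns_saul: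
  fixes p s :: real
  assumes p: "0 < p" "p < 1" and s: "0 \<le> s" "s \<le> 1/2"
  shows "p * exp (- (s * log_odds p)) + (1 - p) * exp (s * log_odds p)
           \<le> exp (2 * s * (s - 1) * ((p - 1/2) * log_odds p))"
proof -
  define v where "v = log_odds p / 2"
  have w: "log_odds p = 2 * v" by (simp add: v_def)
  have e: "exp (2 * v) = p / (1 - p)" using p by (simp add: v_def log_odds_def)
  then have e2: "exp v * exp v * (1 - p) = p"
    using p by (simp add: exp_add[symmetric] field_simps)
  have pv: "p = exp v / (2 * cosh v)"
  proof -
    have "1 + exp v * exp v > 0" by (simp add: add_pos_pos)
    then have "p = exp v * exp v / (1 + exp v * exp v)"
      using e2 by (simp add: eq_divide_eq algebra_simps)
    also have "\<dots> = exp v / (2 * cosh v)"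
      by (simp add: cosh_def exp_minus divide_simps)
    finally show ?thesis .
  qed
  have qv: "1 - p = exp (-v) / (2 * cosh v)"
    using cosh_real_pos[of v] unfolding pv by (simp add: cosh_def field_simps)
  have th: "p - 1/2 = tanh v / 2"
    using cosh_real_pos[of v] unfolding pv
    by (simp add: tanh_def field_simps) (simp add: sinh_def cosh_def field_simps)
  have lhs: "p * exp (- (s * log_odds p)) + (1 - p) * exp (s * log_odds p)
      = cosh (v * (1 - 2 * s)) / cosh v"
    unfolding w qv unfolding pv cosh_def[of "v * (1 - 2 * s)"]
    by (simp add: exp_add[symmetric] add_divide_distrib[symmetric] algebra_simps)
  have rhs: "2 * s * (s - 1) * ((p - 1/2) * log_odds p) = 2 * s * (s - 1) * (v * tanh v)"
    unfolding th w by simp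
  have main: "cosh (x * (1 - 2 * s)) / cosh x \<le> exp (2 * s * (s - 1) * (x * tanh x))"
    if x: "x > 0" for x :: real
  proof -
    have "0 \<le> x * (1 - 2 * s)" "x * (1 - 2 * s) \<le> x"
      using x s by (auto simp: mult_le_cancel_left1 algebra_simps)
    then have "cosh (x * (1 - 2 * s)) / cosh x
        \<le> exp (((x * (1 - 2 * s))\<^sup>2 - x\<^sup>2) * (tanh x / (2 * x)))"
      using x by (rule cosh_ratio_bound)
    \<comment> \<open>This uses (1 - 2 s)^2 - 1 = 4 s (s - 1).\<close>
    also have "((x * (1 - 2 * s))\<^sup>2 - x\<^sup>2) * (tanh x / (2 * x)) = 2 * s * (s - 1) * (x * tanh x)"
      using x by (simp add: field_simps power2_eq_square)
    finally show ?thesis .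
  qed
  \<comment> \<open>Both sides are even in v, so \<open>main\<close> also serves p < 1/2, where v is
    negative. At v = 0, that is p = 1/2, both sides equal 1.\<close>
  consider "v = 0" | "v > 0" | "- v > 0" by linarith
  then show ?thesis
  proof cases
    case 3
    have "cosh (v * (1 - 2 * s)) = cosh (- v * (1 - 2 * s))"
      by (metis cosh_minus minus_mult_left)
    then show ?thesis unfolding lhs rhs using main[OF 3] by simp
  next
    case 2
    then show ?thesis unfolding lhs rhs using main by simp
  qed (simp add: lhs rhs)
qed

section \<open>Chernoff bounds for the binomial distribution\<close>

lemma exp_le_quadratic:
  fixes x :: real
  assumes "x \<le> 2/3"
  shows "exp x \<le> 1 + x + 3/4 * x\<^sup>2"
proof -
  \<comment> \<open>The derivative of \<open>g\<close> has the sign of x (1 - 3 x / 2): it falls up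
    to 0 and rises from 0 to 2/3, so g is at least g 0 = 1. The coefficient 3/4 thus fixes the range
    x \<le> 2/3.\<close>
  define g where "g = (\<lambda>x::real. (1 + x + 3/4 * x\<^sup>2) * exp (- x))"
  have g: "(g has_real_derivative exp (- x) * (x / 2 * (1 - 3/2 * x))) (at x)" for x
    unfolding g_def by (auto intro!: derivative_eq_intros simp: field_simps power2_eq_square)
  have "g 0 \<le> g x"
  proof (cases "x \<ge> 0")
    case True
    then show ?thesis
    proof (rule DERIV_nonneg_imp_nondecreasing)
      fix y assume "0 \<le> y" "y \<le> x"
      then have "0 \<le> exp (- y) * (y / 2 * (1 - 3/2 * y))"
        using assms by (intro mult_nonneg_nonneg) auto
      then show "\<exists>D. (g has_real_derivative D) (at y) \<and> 0 \<le> D"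
        using g by blast
    qed
  next
    case False
    then have "x \<le> 0" by simp
    then show ?thesis
    proof (rule DERIV_nonpos_imp_nonincreasing)
      fix y assume "x \<le> y" "y \<le> 0"
      then have "exp (- y) * (y / 2 * (1 - 3/2 * y)) \<le> 0"
        by (intro mult_nonneg_nonpos mult_nonpos_nonneg) auto
      then show "\<exists>D. (g has_real_derivative D) (at y) \<and> D \<le> 0"
        using g by blast
    qed
  qed
  then show ?thesis by (simp add: g_def exp_minus field_simps)
qed

text \<open>Averaging the quadratic bound cancels the linear terms, since the centred variable has
  mean zero, and leaves the variance p (1 - p), which is at most the smaller of the two
  factors.\<close>

lemma bernoulli_mgf_bound:
  fixes p l :: real
  assumes p: "0 < p" "p < 1" and l: "\<bar>l\<bar> \<le> 2/3"
  shows "p * exp (l * (1 - p)) + (1 - p) * exp (- (l * p)) \<le> exp (3/4 * l\<^sup>2 * min p (1 - p))"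
proof -
  have small: "t * c \<le> 2/3" if "\<bar>t\<bar> \<le> 2/3" "0 < c" "c < 1" for t c :: real
  proof -
    have "t * c \<le> \<bar>t\<bar> * c" using that by (intro mult_right_mono) auto
    also have "\<dots> \<le> \<bar>t\<bar> * 1" using that by (intro mult_left_mono) auto
    finally show ?thesis using that by simp
  qed
  have "exp (l * (1 - p)) \<le> 1 + l * (1 - p) + 3/4 * (l * (1 - p))\<^sup>2"
    using p l by (intro exp_le_quadratic small) auto
  moreover have "exp (- (l * p)) \<le> 1 + - (l * p) + 3/4 * (- (l * p))\<^sup>2"
    using small[of "-l" p] p l by (intro exp_le_quadratic) auto
  ultimately have "p * exp (l * (1 - p)) + (1 - p) * exp (- (l * p))
      \<le> p * (1 + l * (1 - p) + 3/4 * (l * (1 - p))\<^sup>2) + (1 - p) * (1 + - (l * p) + 3/4 * (- (l * p))\<^sup>2)"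
    using p by (intro add_mono mult_left_mono) auto
  also have "\<dots> = 1 + 3/4 * l\<^sup>2 * (p * (1 - p))" by (simp add: power2_eq_square field_simps)
  also have "\<dots> \<le> 1 + 3/4 * l\<^sup>2 * min p (1 - p)"
    using p by (intro add_left_mono mult_left_mono) (auto simp: mult_le_cancel_left1 mult_le_cancel_right1)
  also have "\<dots> \<le> exp (3/4 * l\<^sup>2 * min p (1 - p))" by (rule exp_ge_add_one_self)
  finally show ?thesis .
qed

lemma binomial_exp_expectation:
  fixes p l :: real
  assumes "0 \<le> p" "p \<le> 1"
  shows "measure_pmf.expectation (binomial_pmf m p) (\<lambda>k. exp (l * (real k - real m * p)))
           = (p * exp (l * (1 - p)) + (1 - p) * exp (- (l * p))) ^ m"
proof -
  have "measure_pmf.expectation (binomial_pmf m p) (\<lambda>k. exp (l * (real k - real m * p)))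
      = (\<Sum>k\<le>m. pmf (binomial_pmf m p) k * exp (l * (real k - real m * p)))"
    using set_pmf_binomial_eq[of p m] assms
    by (subst integral_measure_pmf_real[where A = "{..m}"]) (auto split: if_splits simp: mult.commute)
  also have "\<dots> = (\<Sum>k\<le>m. real (m choose k) * (p * exp (l * (1 - p))) ^ k
      * ((1 - p) * exp (- (l * p))) ^ (m - k))"
  proof (intro sum.cong refl)
    fix k assume "k \<in> {..m}"
    then have k: "k \<le> m" by simp
    \<comment> \<open>Each of the k successes contributes 1 - p and each of the m - k failures -p,
      since k - m p = k (1 - p) - (m - k) p.\<close>
    have "exp (l * (real k - real m * p)) = exp (l * (1 - p)) ^ k * exp (- (l * p)) ^ (m - k)"
      using k by (simp add: exp_of_nat_mult[symmetric] exp_add[symmetric] of_nat_diff algebra_simps)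
    then show "pmf (binomial_pmf m p) k * exp (l * (real k - real m * p))
        = real (m choose k) * (p * exp (l * (1 - p))) ^ k * ((1 - p) * exp (- (l * p))) ^ (m - k)"
      using assms by (simp add: power_mult_distrib)
  qed
  also have "\<dots> = (p * exp (l * (1 - p)) + (1 - p) * exp (- (l * p))) ^ m"
    by (rule binomial_ring[symmetric])
  finally show ?thesis .
qed

text \<open>The sign \<open>c\<close> treats the upper and the lower tail at once; the moment bound
  depends only on the square of its parameter.\<close>

lemma binomial_tail_one_sided:
  fixes p r c :: real
  assumes p: "0 < p" "p < 1" and r: "0 < r" "r \<le> 1" and c: "\<bar>c\<bar> = 1"
  defines "\<mu> \<equiv> min p (1 - p)"
  shows "measure_pmf.prob (binomial_pmf m p) {k. r * (real m * \<mu>) \<le> c * (real k - real m * p)}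
           \<le> exp (- (r\<^sup>2 / 3 * (real m * \<mu>)))"
proof -
  \<comment> \<open>This choice minimises 3/4 l^2 - l r, with value -r^2 / 3; r \<le> 1 keeps it in
    the range of \<open>bernoulli_mgf_bound\<close>.\<close>
  define l where "l = 2 / 3 * r"
  have "0 < l" using r by (simp add: l_def)
  let ?B = "binomial_pmf m p"
  have int: "integrable (measure_pmf ?B) f" for f :: "nat \<Rightarrow> real"
    using p set_pmf_binomial_eq[of p m] by (intro integrable_measure_pmf_finite) (auto split: if_splits)
  have c2: "c\<^sup>2 = 1" using c by (metis one_power2 power2_abs)
  have "measure_pmf.prob ?B {k. r * (real m * \<mu>) \<le> c * (real k - real m * p)}
      \<le> measure_pmf.prob ?B {k \<in> space (measure_pmf ?B). exp (l * (c * (real k - real m * p))) \<ge> exp (l * (r * (real m * \<mu>)))}"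
    using \<open>0 < l\<close> by (intro measure_pmf.finite_measure_mono) (auto intro!: mult_left_mono)
  also have "\<dots> \<le> measure_pmf.expectation ?B (\<lambda>k. exp (l * (c * (real k - real m * p)))) / exp (l * (r * (real m * \<mu>)))"
    by (intro integral_Markov_inequality_measure[where A = "{}"] int) auto
  also have "measure_pmf.expectation ?B (\<lambda>k. exp (l * (c * (real k - real m * p))))
      = (p * exp ((l * c) * (1 - p)) + (1 - p) * exp (- ((l * c) * p))) ^ m"
    using binomial_exp_expectation[of p m "l * c"] p by (simp add: mult.assoc)
  also have "\<dots> \<le> exp (3/4 * (l * c)\<^sup>2 * \<mu>) ^ m"
    unfolding \<mu>_def using p r c
    by (intro power_mono bernoulli_mgf_bound) (auto simp: l_def abs_mult)
  also have "\<dots> = exp (3/4 * l\<^sup>2 * (real m * \<mu>))"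
    by (simp add: exp_of_nat_mult[symmetric] power_mult_distrib c2 algebra_simps)
  finally have "measure_pmf.prob ?B {k. r * (real m * \<mu>) \<le> c * (real k - real m * p)}
      \<le> exp (3/4 * l\<^sup>2 * (real m * \<mu>)) / exp (l * (r * (real m * \<mu>)))"
    by (simp add: divide_right_mono)
  also have "\<dots> = exp (- (r\<^sup>2 / 3 * (real m * \<mu>)))"
    unfolding exp_diff[symmetric] by (simp add: l_def power2_eq_square field_simps)
  finally show ?thesis .
qed

lemma binomial_tail:
  fixes p r :: real
  assumes p: "0 < p" "p < 1" and r: "0 < r" "r \<le> 1"
  defines "\<mu> \<equiv> min p (1 - p)"
  shows "measure_pmf.prob (binomial_pmf m p) {k. r * (real m * \<mu>) \<le> \<bar>real k - real m * p\<bar>}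
           \<le> 2 * exp (- (r\<^sup>2 / 3 * (real m * \<mu>)))"
proof -
  let ?T = "\<lambda>c. {k. r * (real m * \<mu>) \<le> c * (real k - real m * p)}"
  have "measure_pmf.prob (binomial_pmf m p) {k. r * (real m * \<mu>) \<le> \<bar>real k - real m * p\<bar>}
      \<le> measure_pmf.prob (binomial_pmf m p) (?T 1 \<union> ?T (-1))"
    by (intro measure_pmf.finite_measure_mono) auto
  also have "\<dots> \<le> measure_pmf.prob (binomial_pmf m p) (?T 1) + measure_pmf.prob (binomial_pmf m p) (?T (-1))"
    by (intro measure_Un_le) auto
  also have "\<dots> \<le> 2 * exp (- (r\<^sup>2 / 3 * (real m * \<mu>)))"
    using binomial_tail_one_sided[OF p r, of 1 m] binomial_tail_one_sided[OF p r, of "-1" m]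
    unfolding \<mu>_def by linarith
  finally show ?thesis .
qed

section \<open>Effect of relative errors on the log-odds\<close>

text \<open>As ln (1 + r) \<le> r, it remains to see that - ln (1 - r) is at most x = r + 4 r^2,
  that is 1 \<le> (1 - r) exp x. The second-order Taylor bound for exp x reduces this to a
  polynomial inequality.\<close>

lemma ln_ratio_bound:
  fixes r :: real
  assumes r: "0 < r" "r \<le> 9/10"
  shows "ln (1 + r) - ln (1 - r) \<le> 2 * r + 4 * r\<^sup>2"
proof -
  define x where "x = r + 4 * r\<^sup>2"
  have "0 \<le> x" using r by (simp add: x_def)
  \<comment> \<open>These two bounds make the cubic below at least 7/2 - 9/20 - 16/5 * 81/100, which
    is positive.\<close>
  have "r\<^sup>2 * r \<le> r\<^sup>2 * (9/10)" using r by (intro mult_left_mono) auto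
  moreover have "r\<^sup>2 \<le> 81/100" using power_mono[of r "9/10" 2] r by (simp add: power_divide)
  ultimately have "0 \<le> 7/2 - r / 2 + 4 * r\<^sup>2 - 8 * (r\<^sup>2 * r)" using r by linarith
  then have "0 \<le> r\<^sup>2 * (7/2 - r / 2 + 4 * r\<^sup>2 - 8 * (r\<^sup>2 * r))" by simp
  moreover have "(1 - r) * (1 + x + x\<^sup>2 / 2) = 1 + r\<^sup>2 * (7/2 - r / 2 + 4 * r\<^sup>2 - 8 * (r\<^sup>2 * r))"
    by (simp add: x_def power2_eq_square field_simps)
  ultimately have "1 \<le> (1 - r) * (1 + x + x\<^sup>2 / 2)" by linarith
  also have "\<dots> \<le> (1 - r) * exp x"
    using r \<open>0 \<le> x\<close> by (intro mult_left_mono exp_lower_Taylor_quadratic) auto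
  finally have "ln 1 \<le> ln ((1 - r) * exp x)"
    by (subst ln_le_cancel_iff) (use r in auto)
  also have "\<dots> = ln (1 - r) + x" using r by (simp add: ln_mult)
  finally have "- ln (1 - r) \<le> x" by simp
  moreover have "ln (1 + r) \<le> r" using r by (intro ln_add_one_self_le_self) auto
  ultimately show ?thesis by (simp add: x_def)
qed

text \<open>The minimum makes the error relative to both p and 1 - p: a/p and (1 - a)/(1 - p) lie
  between 1 - r and 1 + r. The lower bounds keep a strictly inside the unit interval, and the
  log-odds move most when the two ratios err in opposite directions.\<close>

lemma log_odds_perturbation:
  fixes p a r :: real
  assumes p: "0 < p" "p < 1" and r: "0 < r" "r < 1" and a: "\<bar>a - p\<bar> \<le> r * min p (1 - p)"
  shows "0 < a" "a < 1" "\<bar>log_odds a - log_odds p\<bar> \<le> ln (1 + r) - ln (1 - r)"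
proof -
  have "r * min p (1 - p) \<le> r * p" "r * min p (1 - p) \<le> r * (1 - p)"
    using r by (auto intro!: mult_left_mono)
  with a have b: "p * (1 - r) \<le> a" "a \<le> p * (1 + r)"
    "(1 - p) * (1 - r) \<le> 1 - a" "1 - a \<le> (1 - p) * (1 + r)"
    by (auto simp: abs_le_iff algebra_simps)
  have "0 < p * (1 - r)" "0 < (1 - p) * (1 - r)" using p r by auto
  with b show a01: "0 < a" "a < 1" by linarith+
  have ln: "ln x + ln y \<le> ln z" if "0 < x" "0 < y" "x * y \<le> z" for x y z :: real
    using that by (metis ln_mono ln_mult_pos mult_pos_pos)
  have ln': "ln z \<le> ln x + ln y" if "0 < x" "0 < y" "0 < z" "z \<le> x * y" for x y z :: real
    using that by (metis ln_mono ln_mult_pos)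
  have "ln p + ln (1 - r) \<le> ln a" "ln a \<le> ln p + ln (1 + r)"
    "ln (1 - p) + ln (1 - r) \<le> ln (1 - a)" "ln (1 - a) \<le> ln (1 - p) + ln (1 + r)"
    using b p r a01 by (auto intro: ln ln')
  moreover have "log_odds x = ln x - ln (1 - x)" if "0 < x" "x < 1" for x
    using that by (simp add: log_odds_def ln_div)
  ultimately show "\<bar>log_odds a - log_odds p\<bar> \<le> ln (1 + r) - ln (1 - r)"
    using a01 p by (simp add: abs_le_iff)
qed

lemma hc_weight_eq_log_odds:
  assumes "0 < real k / real m" "real k / real m < 1"
  shows "hc_weight m k = ereal (log_odds (real k / real m))"
  using assms by (cases "m = 0") (auto simp: hc_weight_def Let_def zero_less_divide_iff)

section \<open>Tail bounds for the weighted vote and for the profile\<close>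

context expert_committee
begin

definition correctness_sign :: "nat \<Rightarrow> 'a \<Rightarrow> real" where
  "correctness_sign i \<omega> = 2 * of_bool (X i \<omega> = Y \<omega>) - 1"

text \<open>Finite weights rule out indeterminate sums, so an error means a nonpositive plug-in
  margin. Signs have modulus 1, hence exchanging each weight for \<open>w i\<close> costs at most e
  per expert.\<close>

lemma hc_error_imp_small_margin:
  assumes \<omega>: "\<omega> \<in> space M"
    and close: "\<And>i. i \<in> {1..n} \<Longrightarrow>
      \<exists>a. hc_weight (m i) (K i \<omega>) = ereal a \<and> \<bar>a - w i\<bar> \<le> e"
    and err: "hc_rule n m (\<lambda>i. X i \<omega>) (\<lambda>i. K i \<omega>) \<noteq> ereal (Y \<omega>)"
  shows "(\<Sum>i=1..n. w i * correctness_sign i \<omega>) \<le> real n * e"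
proof -
  obtain a where a: "\<And>i. i \<in> {1..n} \<Longrightarrow> hc_weight (m i) (K i \<omega>) = ereal (a i)"
      "\<And>i. i \<in> {1..n} \<Longrightarrow> \<bar>a i - w i\<bar> \<le> e"
    using close by metis
  let ?t = "\<lambda>i. hc_weight (m i) (K i \<omega>) * ereal (2 * of_bool (X i \<omega> = Y \<omega>) - 1)"
  have t: "?t i = ereal (a i * correctness_sign i \<omega>)" if "i \<in> {1..n}" for i
    using a(1)[OF that] by (simp add: correctness_sign_def)
  have "\<not> indeterminate_sum n ?t" using t by (auto simp: indeterminate_sum_def)
  then have "(\<Sum>i=1..n. ?t i) \<le> 0" using hc_error_iff[OF \<omega>] err by blast
  also have "(\<Sum>i=1..n. ?t i) = (\<Sum>i=1..n. ereal (a i * correctness_sign i \<omega>))"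
    by (intro sum.cong t refl)
  finally have "(\<Sum>i=1..n. a i * correctness_sign i \<omega>) \<le> 0" by simp
  moreover have "(\<Sum>i=1..n. w i * correctness_sign i \<omega>)
      \<le> (\<Sum>i=1..n. a i * correctness_sign i \<omega> + e)"
    using a(2) by (intro sum_mono) (fastforce simp: correctness_sign_def abs_le_iff)
  ultimately show ?thesis by (simp add: sum.distrib)
qed

lemma correctness_sign_measurable:
  assumes "i \<in> {1..n}"
  shows "correctness_sign i \<in> borel_measurable M"
proof -
  have [measurable]: "X i \<in> borel_measurable M" "Y \<in> borel_measurable M"
    using X_measurable[OF assms] Y_measurable by auto
  show ?thesis unfolding correctness_sign_def[abs_def] by measurable
qed

lemma correctness_sign_mgf:
  assumes i: "i \<in> {1..n}"
  shows "expectation (\<lambda>\<omega>. exp (c * correctness_sign i \<omega>)) = p i * exp c + (1 - p i) * exp (- c)"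
proof -
  have [measurable]: "X i \<in> borel_measurable M" "Y \<in> borel_measurable M"
    using X_measurable[OF i] Y_measurable by auto
  let ?C = "{\<omega> \<in> space M. X i \<omega> = Y \<omega>}"
  have C[measurable]: "?C \<in> sets M" by measurable
  have "expectation (\<lambda>\<omega>. exp (c * correctness_sign i \<omega>))
      = expectation (\<lambda>\<omega>. exp (- c) + (exp c - exp (- c)) * indicator ?C \<omega>)"
    by (intro Bochner_Integration.integral_cong) (auto simp: correctness_sign_def)
  also have "\<dots> = exp (- c) + (exp c - exp (- c)) * prob ?C"
    using C by (subst Bochner_Integration.integral_add) (auto simp: prob_space emeasure_eq_measure)
  finally show ?thesis using competence[OF i] by (simp add: algebra_simps)
qed

text \<open>Chernoff's method: by independence the exponential moment factorises, and Kearns-Saul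
  bounds each factor by its share of the potential.\<close>

lemma weighted_vote_tail:
  assumes p: "\<And>i. i \<in> {1..n} \<Longrightarrow> 0 < p i \<and> p i < 1"
    and \<Phi>: "\<Phi> = committee_potential n p"
    and b: "0 \<le> b" "b < 2 * \<Phi>"
  shows "prob {\<omega> \<in> space M. (\<Sum>i=1..n. log_odds (p i) * correctness_sign i \<omega>) \<le> b}
           \<le> exp (- ((2 * \<Phi> - b)\<^sup>2 / (8 * \<Phi>)))"
proof -
  \<comment> \<open>The minimiser of 2 s (s - 1) \<Phi> + s b. The conditions b < 2 \<Phi> and 0
    \<le> b give 0 < s and s \<le> 1/2, as \<open>kearns_saul\<close> requires.\<close>
  define s where "s = (2 * \<Phi> - b) / (4 * \<Phi>)"
  have \<Phi>0: "\<Phi> > 0" using b by simp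
  have s: "0 < s" "s \<le> 1/2" using b \<Phi>0 by (auto simp: s_def field_simps)
  let ?w = "\<lambda>i. log_odds (p i)"
  let ?f = "\<lambda>i \<omega>. exp (- (s * ?w i) * correctness_sign i \<omega>)"
  have meas: "?f i \<in> borel_measurable M" if "i \<in> {1..n}" for i
    using correctness_sign_measurable[OF that] by measurable
  have int: "integrable M (?f i)" if "i \<in> {1..n}" for i
  proof (rule integrable_const_bound[where B = "exp \<bar>s * ?w i\<bar>"])
    show "AE \<omega> in M. norm (?f i \<omega>) \<le> exp \<bar>s * ?w i\<bar>"
      by (auto simp: correctness_sign_def)
  qed (rule meas[OF that])
  have indep: "indep_vars (\<lambda>_. borel) ?f {1..n}"
  proof -
    \<comment> \<open>Each factor is a function of one correctness indicator, so it inherits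
      independence from \<open>correct_indep\<close>.\<close>
    have "indep_vars (\<lambda>_. borel)
        (\<lambda>i. (\<lambda>x::nat. exp (- (s * ?w i) * (2 * real x - 1))) \<circ> (\<lambda>\<omega>. of_bool (X i \<omega> = Y \<omega>))) {1..n}"
      by (rule indep_vars_compose[OF correct_indep]) auto
    then show ?thesis by (simp add: o_def correctness_sign_def)
  qed
  have prod: "integrable M (\<lambda>\<omega>. \<Prod>i\<in>{1..n}. ?f i \<omega>)"
      "expectation (\<lambda>\<omega>. \<Prod>i\<in>{1..n}. ?f i \<omega>) = (\<Prod>i\<in>{1..n}. expectation (?f i))"
    using indep int by (auto intro!: indep_vars_integrable indep_vars_lebesgue_integral)
  have eq: "(\<Prod>i\<in>{1..n}. ?f i \<omega>) = exp (- (s * (\<Sum>i=1..n. ?w i * correctness_sign i \<omega>)))" for \<omega>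
    by (simp add: exp_sum[symmetric] sum_distrib_left sum_negf[symmetric] mult.assoc)
  have "prob {\<omega> \<in> space M. (\<Sum>i=1..n. ?w i * correctness_sign i \<omega>) \<le> b}
      = prob {\<omega> \<in> space M. (\<Prod>i\<in>{1..n}. ?f i \<omega>) \<ge> exp (- (s * b))}"
    unfolding eq using s by simp
  also have "\<dots> \<le> expectation (\<lambda>\<omega>. \<Prod>i\<in>{1..n}. ?f i \<omega>) / exp (- (s * b))"
    by (intro integral_Markov_inequality_measure[where A = "{}"] prod AE_I2 prod_nonneg) auto
  also have "\<dots> \<le> exp (2 * s * (s - 1) * \<Phi>) / exp (- (s * b))"
  proof (intro divide_right_mono)
    have "(\<Prod>i\<in>{1..n}. expectation (?f i))
        \<le> (\<Prod>i\<in>{1..n}. exp (2 * s * (s - 1) * ((p i - 1/2) * ?w i)))"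
    proof (intro prod_mono conjI)
      fix i assume i: "i \<in> {1..n}"
      show "0 \<le> expectation (?f i)" by simp
      show "expectation (?f i) \<le> exp (2 * s * (s - 1) * ((p i - 1/2) * ?w i))"
        unfolding correctness_sign_mgf[OF i]
        using kearns_saul[of "p i" s] p[OF i] s by simp
    qed
    also have "\<dots> = exp (2 * s * (s - 1) * \<Phi>)"
      by (simp add: exp_sum[symmetric] \<Phi> committee_potential_def sum_distrib_left)
    finally show "expectation (\<lambda>\<omega>. \<Prod>i\<in>{1..n}. ?f i \<omega>) \<le> exp (2 * s * (s - 1) * \<Phi>)"
      unfolding prod(2) .
  qed simp
  also have "\<dots> = exp (- ((2 * \<Phi> - b)\<^sup>2 / (8 * \<Phi>)))"
  proof -
    have "2 * s * (s - 1) * \<Phi> - - (s * b) = - ((2 * \<Phi> - b)\<^sup>2 / (8 * \<Phi>))"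
      using \<Phi>0 by (simp add: s_def field_simps power2_eq_square)
    then show ?thesis unfolding exp_diff[symmetric] by simp
  qed
  finally show ?thesis .
qed

lemma profile_measurable:
  assumes "i \<in> {1..n}"
  shows "K i \<in> measurable M (count_space UNIV)"
  using K_indep assms by (auto simp: indep_vars_def)

lemma profile_tail:
  assumes i: "i \<in> {1..n}" and p: "0 < p i" "p i < 1" and r: "0 < r" "r \<le> 1"
  defines "\<mu> \<equiv> min (p i) (1 - p i)"
  shows "prob {\<omega> \<in> space M. r * (real (m i) * \<mu>) \<le> \<bar>real (K i \<omega>) - real (m i) * p i\<bar>}
           \<le> 2 * exp (- (r\<^sup>2 / 3 * (real (m i) * \<mu>)))"
proof -
  let ?T = "{k. r * (real (m i) * \<mu>) \<le> \<bar>real k - real (m i) * p i\<bar>}"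
  have "prob {\<omega> \<in> space M. r * (real (m i) * \<mu>) \<le> \<bar>real (K i \<omega>) - real (m i) * p i\<bar>}
      = prob (K i -` ?T \<inter> space M)"
    by (rule arg_cong[where f = prob]) auto
  also have "\<dots> = measure (distr M (count_space UNIV) (K i)) ?T"
    by (rule measure_distr[OF profile_measurable[OF i], symmetric]) simp
  also have "\<dots> \<le> 2 * exp (- (r\<^sup>2 / 3 * (real (m i) * \<mu>)))"
    unfolding K_binomial[OF i] \<mu>_def by (rule binomial_tail[OF p r])
  finally show ?thesis .
qed

end

section \<open>Union bound over inaccurate frequencies and a small true margin\<close>

theorem theorem9:
  fixes M :: "'a measure"
    and n :: nat
    and p :: "nat \<Rightarrow> real"
    and m :: "nat \<Rightarrow> nat"
    and X :: "nat \<Rightarrow> 'a \<Rightarrow> real"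
    and Y :: "'a \<Rightarrow> real"
    and K :: "nat \<Rightarrow> 'a \<Rightarrow> nat"
    and \<delta> \<epsilon> \<Phi> :: real
  assumes "n \<ge> 1"
    and "\<And>i. i \<in> {1..n} \<Longrightarrow> 0 < p i \<and> p i < 1"
    and "\<And>i. i \<in> {1..n} \<Longrightarrow> m i > 0"
    and "expert_committee M n p m X Y K"
    and "\<Phi> = committee_potential n p"
    and "0 < \<delta>" and "\<delta> < 1"
    and "0 < \<epsilon>" and "\<epsilon> < min 5 (2 * \<Phi> / real n)"
    and "\<And>i. i \<in> {1..n} \<Longrightarrow>
           real (m i) * min (p i) (1 - p i)
             \<ge> 3 * ((sqrt (4 * \<epsilon> + 1) - 1) / 4) powi (-2) * ln (4 * real n / \<delta>)"
  shows "measure M {\<omega> \<in> space M.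
             hc_rule n m (\<lambda>i. X i \<omega>) (\<lambda>i. K i \<omega>) \<noteq> ereal (Y \<omega>)}
           \<le> \<delta> + exp (- ((2 * \<Phi> - \<epsilon> * real n)\<^sup>2 / (8 * \<Phi>)))"
proof -
  interpret expert_committee M n p m X Y K by fact
  note p = assms(2) and mpos = assms(3)
  \<comment> \<open>The positive root of 4 r^2 + 2 r = \<epsilon>, so that
    \<open>ln_ratio_bound\<close> yields exactly \<epsilon>.\<close>
  define r where "r = (sqrt (4 * \<epsilon> + 1) - 1) / 4"
  have n0: "real n > 0" using assms(1) by simp
  have "sqrt 1 < sqrt (4 * \<epsilon> + 1)" using assms(8) by (subst real_sqrt_less_iff) simp
  then have r0: "0 < r" by (simp add: r_def)
  \<comment> \<open>Here \<epsilon> < 5 enters: 4 \<epsilon> + 1 < 21 < 4.6^2, which gives the range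
    r \<le> 9/10 of \<open>ln_ratio_bound\<close>.\<close>
  have "sqrt (4 * \<epsilon> + 1) \<le> 46/10"
    using assms(9) by (intro real_le_lsqrt) (auto simp: power2_eq_square)
  then have r9: "r \<le> 9/10" by (simp add: r_def)
  have "(4 * r + 1)\<^sup>2 = 4 * \<epsilon> + 1" using assms(8) by (simp add: r_def diff_divide_distrib)
  then have \<epsilon>r: "\<epsilon> = 2 * r + 4 * r\<^sup>2" by (simp add: power2_eq_square algebra_simps)
  define bad where "bad i = {\<omega> \<in> space M. r * (real (m i) * min (p i) (1 - p i))
      \<le> \<bar>real (K i \<omega>) - real (m i) * p i\<bar>}" for i
  define vote where "vote = {\<omega> \<in> space M.
      (\<Sum>i=1..n. log_odds (p i) * correctness_sign i \<omega>) \<le> \<epsilon> * real n}"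
  have bad_sets: "bad i \<in> sets M" if "i \<in> {1..n}" for i
    using profile_measurable[OF that] unfolding bad_def by measurable
  have vote_sets: "vote \<in> sets M"
    unfolding vote_def using correctness_sign_measurable by measurable
  have bad_prob: "prob (bad i) \<le> \<delta> / (2 * real n)" if i: "i \<in> {1..n}" for i
  proof -
    have "prob (bad i) \<le> 2 * exp (- (r\<^sup>2 / 3 * (real (m i) * min (p i) (1 - p i))))"
      unfolding bad_def using p[OF i] r0 r9 by (intro profile_tail i) auto
    \<comment> \<open>The factor 3 / r^2 in the sample-size hypothesis cancels the r^2 / 3 of the
      tail exponent.\<close>
    also have "\<dots> \<le> 2 * exp (- ln (4 * real n / \<delta>))"
    proof -
      have "3 / r\<^sup>2 * ln (4 * real n / \<delta>) \<le> real (m i) * min (p i) (1 - p i)"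
        using assms(10)[OF i] by (simp add: r_def power_int_minus field_simps)
      then have "r\<^sup>2 / 3 * (3 / r\<^sup>2 * ln (4 * real n / \<delta>)) \<le> r\<^sup>2 / 3 * (real (m i) * min (p i) (1 - p i))"
        by (intro mult_left_mono) auto
      then show ?thesis using r0 by simp
    qed
    also have "\<dots> = \<delta> / (2 * real n)"
      using n0 assms(6) by (simp add: exp_minus)
    finally show ?thesis .
  qed
  have "{\<omega> \<in> space M. hc_rule n m (\<lambda>i. X i \<omega>) (\<lambda>i. K i \<omega>) \<noteq> ereal (Y \<omega>)}
      \<subseteq> (\<Union>i\<in>{1..n}. bad i) \<union> vote"
  proof (rule subsetI)
    fix \<omega> assume "\<omega> \<in> {\<omega> \<in> space M. hc_rule n m (\<lambda>i. X i \<omega>) (\<lambda>i. K i \<omega>) \<noteq> ereal (Y \<omega>)}"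
    then have \<omega>: "\<omega> \<in> space M" "hc_rule n m (\<lambda>i. X i \<omega>) (\<lambda>i. K i \<omega>) \<noteq> ereal (Y \<omega>)"
      by auto
    show "\<omega> \<in> (\<Union>i\<in>{1..n}. bad i) \<union> vote"
    proof (cases "\<omega> \<in> (\<Union>i\<in>{1..n}. bad i)")
      case False
      have "\<exists>a. hc_weight (m i) (K i \<omega>) = ereal a \<and> \<bar>a - log_odds (p i)\<bar> \<le> \<epsilon>"
        if i: "i \<in> {1..n}" for i
      proof -
        let ?a = "real (K i \<omega>) / real (m i)"
        have m0: "real (m i) > 0" using mpos[OF i] by simp
        have "\<bar>real (K i \<omega>) - real (m i) * p i\<bar> \<le> r * (real (m i) * min (p i) (1 - p i))"
          using False i \<omega>(1) by (fastforce simp: bad_def)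
        moreover have "real (K i \<omega>) - real (m i) * p i = real (m i) * (?a - p i)"
          using m0 by (simp add: algebra_simps)
        ultimately have "real (m i) * \<bar>?a - p i\<bar> \<le> real (m i) * (r * min (p i) (1 - p i))"
          using m0 by (simp add: abs_mult mult.left_commute)
        then have "\<bar>?a - p i\<bar> \<le> r * min (p i) (1 - p i)"
          using m0 by (simp only: mult_le_cancel_left_pos)
        note a = log_odds_perturbation[OF _ _ r0 _ this]
        have "\<bar>log_odds ?a - log_odds (p i)\<bar> \<le> \<epsilon>"
          using a(3) ln_ratio_bound[OF r0 r9] p[OF i] r9 \<epsilon>r by linarith
        moreover have "hc_weight (m i) (K i \<omega>) = ereal (log_odds ?a)"
          using a(1,2) p[OF i] r9 by (intro hc_weight_eq_log_odds) auto
        ultimately show ?thesis by blast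
      qed
      from hc_error_imp_small_margin[OF \<omega>(1) this \<omega>(2)] show ?thesis
        using \<omega>(1) by (simp add: vote_def mult.commute)
    qed simp
  qed
  \<comment> \<open>Monotonicity asks for measurability of the covering set only, which
    \<open>bad_sets\<close> and \<open>vote_sets\<close> supply.\<close>
  then have "prob {\<omega> \<in> space M. hc_rule n m (\<lambda>i. X i \<omega>) (\<lambda>i. K i \<omega>) \<noteq> ereal (Y \<omega>)}
      \<le> prob ((\<Union>i\<in>{1..n}. bad i) \<union> vote)"
    using bad_sets vote_sets by (intro finite_measure_mono) auto
  also have "\<dots> \<le> prob (\<Union>i\<in>{1..n}. bad i) + prob vote"
    using bad_sets vote_sets by (intro measure_Un_le) auto
  also have "prob (\<Union>i\<in>{1..n}. bad i) \<le> (\<Sum>i\<in>{1..n}. prob (bad i))"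
    using bad_sets by (intro finite_measure_subadditive_finite) auto
  also have "\<dots> \<le> (\<Sum>i\<in>{1..n}. \<delta> / (2 * real n))" by (intro sum_mono bad_prob)
  \<comment> \<open>The sum equals \<delta> / 2.\<close>
  also have "\<dots> \<le> \<delta>" using n0 assms(6) by simp
  \<comment> \<open>The threshold is b = \<epsilon> n, and \<epsilon> < 2 \<Phi> / n says that it
    lies below 2 \<Phi>.\<close>
  also have "prob vote \<le> exp (- ((2 * \<Phi> - \<epsilon> * real n)\<^sup>2 / (8 * \<Phi>)))"
    unfolding vote_def
    using assms(8,9) n0 by (intro weighted_vote_tail p assms(5)) (auto simp: field_simps)
  finally show ?thesis by simp
qed

end
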